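(* Let $X$ be a Tychonoff space and let $E\subset C(X)$ be a sublattice. Then: (i) If $H$ is an ideal in $E$ such that $\mathrm{supp}\,H$ is dense in $\mathrm{supp}\,E$, then $H$ is order dense in $E$. (ii) If $E$ is regular in $C(X)$ and $H$ is an order dense ideal in $E$, then $\mathrm{supp}\,H$ is dense in $\mathrm{supp}\,E$. (iii) If $E$ is not regular in $C(X)$, and either $E\subset C_b(X)$ or $X$ is almost locally compact, then there is an order dense ideal $H$ of $E$ such that $\mathrm{supp}\,H$ is not dense in $\mathrm{supp}\,E$.
   Context: $C(X)$ is the vector lattice of all continuous real-valued functions on $X$ with pointwise operations, and $C_b(X)$ its sublattice of bounded functions. A sublattice is a linear subspace closed under the lattice operations. An ideal of a vector lattice $E$ is a linear subspace $H\subset E$ such that $|f|\le|h|$, $h\in H$, $f\in E$ imply $f\in H$. A sublattice $H\subset E$ is order dense in $E$ if for every $0<e\in E$ there is $h\in H$ with $0<h\le e$. A sublattice $E\subset C(X)$ is regular if for every $R\subset E$ and $r\in E$: if $r$ is the supremum of $R$ in $E$, then $r$ is the supremum of $R$ in $C(X)$, and the same for infima. For a function $f$, $\mathrm{supp}\,f=\{x:f(x)\ne0\}$ (no closure taken); for a set $G$ of functions, $\mathrm{supp}\,G=\bigcup_{g\in G}\mathrm{supp}\,g$. $X$ is almost locally compact if the set of all points of $X$ that have a compact neighborhood is dense in $X$. *)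

theory Defs
  imports "HOL-Analysis.Analysis" "HOL-Library.Lub_Glb"
begin

text \<open>
  Real-valued functions carry the pointwise order and lattice operations of the library's
  function instances (so \<open>(\<lambda>_. 0) < e\<close> means \<open>e \<ge> 0\<close> everywhere and \<open>e\<close> is not the zero
  function). A vector lattice of functions is represented by its set of elements.
\<close>

definition tychonoff_space :: "'a topology \<Rightarrow> bool"
  where "tychonoff_space X \<longleftrightarrow> Hausdorff_space X \<and> completely_regular_space X"

definition cont_functions :: "('a::topological_space \<Rightarrow> real) set"
  where "cont_functions = {f. continuous_on UNIV f}"

definition bounded_cont_functions :: "('a::topological_space \<Rightarrow> real) set"
  where "bounded_cont_functions = {f \<in> cont_functions. bounded (range f)}"

definition function_subspace :: "('a \<Rightarrow> real) set \<Rightarrow> bool"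
  where "function_subspace V \<longleftrightarrow>
    (\<lambda>_. 0) \<in> V \<and>
    (\<forall>f\<in>V. \<forall>g\<in>V. (\<lambda>x. f x + g x) \<in> V) \<and>
    (\<forall>c. \<forall>f\<in>V. (\<lambda>x. c * f x) \<in> V)"

definition sublattice_of :: "('a \<Rightarrow> real) set \<Rightarrow> ('a \<Rightarrow> real) set \<Rightarrow> bool"
  where "sublattice_of H E \<longleftrightarrow>
    H \<subseteq> E \<and> function_subspace H \<and> (\<forall>f\<in>H. \<forall>g\<in>H. sup f g \<in> H \<and> inf f g \<in> H)"

definition ideal_of :: "('a \<Rightarrow> real) set \<Rightarrow> ('a \<Rightarrow> real) set \<Rightarrow> bool"
  where "ideal_of H E \<longleftrightarrow>
    H \<subseteq> E \<and> function_subspace H \<and>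
    (\<forall>h\<in>H. \<forall>f\<in>E. (\<lambda>x. \<bar>f x\<bar>) \<le> (\<lambda>x. \<bar>h x\<bar>) \<longrightarrow> f \<in> H)"

definition order_dense_in :: "('a \<Rightarrow> real) set \<Rightarrow> ('a \<Rightarrow> real) set \<Rightarrow> bool"
  where "order_dense_in H E \<longleftrightarrow>
    sublattice_of H E \<and>
    (\<forall>e\<in>E. (\<lambda>_. 0) < e \<longrightarrow> (\<exists>h\<in>H. (\<lambda>_. 0) < h \<and> h \<le> e))"

text \<open>
  \<open>isLub E R r\<close> says that \<open>r\<close> is the supremum of \<open>R\<close> in the ordered set \<open>E\<close>. Only nonempty
  \<open>R\<close> are considered: the empty set has the supremum \<open>0\<close> in \<open>E = {0}\<close> but none in \<open>C(X)\<close>,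
  so admitting it would make the zero sublattice irregular; for \<open>E \<noteq> {0}\<close> the empty set has
  neither supremum nor infimum in \<open>E\<close>.
\<close>

definition regular_sublattice :: "('a::topological_space \<Rightarrow> real) set \<Rightarrow> bool"
  where "regular_sublattice E \<longleftrightarrow>
    sublattice_of E cont_functions \<and>
    (\<forall>R r. R \<subseteq> E \<and> R \<noteq> {} \<longrightarrow>
      (isLub E R r \<longrightarrow> isLub cont_functions R r) \<and>
      (isGlb E R r \<longrightarrow> isGlb cont_functions R r))"

text \<open>The support of a function is not closed here.\<close>

definition supp_family :: "('a \<Rightarrow> real) set \<Rightarrow> 'a set"
  where "supp_family G = (\<Union>g\<in>G. support_on UNIV g)"

definition dense_subset_of :: "'a::topological_space set \<Rightarrow> 'a set \<Rightarrow> bool"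
  where "dense_subset_of A B \<longleftrightarrow> A \<subseteq> B \<and> B \<subseteq> closure A"

definition almost_locally_compact :: "'a::topological_space itself \<Rightarrow> bool"
  where "almost_locally_compact _ \<longleftrightarrow>
    closure {x::'a. \<exists>K. compact K \<and> x \<in> interior K} = UNIV"

end

theory Submission
  imports Defs
begin

text \<open>
  For an ideal, order density is tested by cutting: given \<open>0 < e\<close> in \<open>E\<close>, a member of \<open>H\<close>
  below \<open>e\<close> is sought as an infimum \<open>\<bar>h\<bar> \<sqinter> e\<close>. If \<open>supp H\<close> is dense in
  \<open>supp E\<close>, then some \<open>h \<in> H\<close> is nonzero at a point of the open set \<open>{e > 0}\<close>, and the
  infimum is nonzero there. This is (i).

  For (ii), the Archimedean property shows that every \<open>e \<ge> 0\<close> in \<open>E\<close> is the supremum in \<open>E\<close>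
  of \<open>R = {h \<in> H. 0 \<le> h \<le> e}\<close> (lemma \<open>isLub_order_dense_ideal\<close>), hence also in \<open>C(X)\<close> by
  regularity. If \<open>e\<close> were nonzero at a point off the closure of \<open>supp H\<close>, multiplying \<open>e\<close> by
  a continuous function that vanishes at the point and is \<open>1\<close> on that closure
  would give a smaller upper bound of \<open>R\<close> in \<open>C(X)\<close>.

  For (iii), a failure of regularity translates into a set \<open>F \<subseteq> E\<close> of nonnegative functions
  without positive lower bound in \<open>E\<close> but bounded below by a constant \<open>\<delta> > 0\<close> on a
  nonempty open set \<open>U\<close> (lemma \<open>not_regular_witness\<close>). The ideal \<open>H\<close> consists of the members of
  \<open>E\<close> that vanish on a nonempty open \<open>V \<subseteq> U\<close> on which every member of \<open>E\<close> is bounded. Given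
  \<open>0 < e\<close> with \<open>e \<le> M\<close> on \<open>V\<close>, the functions \<open>(e - (M/\<delta>) f)\<^sup>+\<close> with \<open>f \<in> F\<close> belong to \<open>H\<close>
  and lie below \<open>e\<close>; they cannot all be zero, since then \<open>(\<delta>/M) e\<close> would be a positive lower
  bound of \<open>F\<close> (lemma \<open>vanishing_ideal_order_dense\<close>).
\<close>

section \<open>Sublattices and ideals of functions\<close>

lemma sublattice_of_zero: "sublattice_of E C \<Longrightarrow> (\<lambda>_. 0) \<in> E"
  and sublattice_of_add: "sublattice_of E C \<Longrightarrow> f \<in> E \<Longrightarrow> g \<in> E \<Longrightarrow> (\<lambda>x. f x + g x) \<in> E"
  and sublattice_of_scale: "sublattice_of E C \<Longrightarrow> f \<in> E \<Longrightarrow> (\<lambda>x. c * f x) \<in> E"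
  and sublattice_of_sup: "sublattice_of E C \<Longrightarrow> f \<in> E \<Longrightarrow> g \<in> E \<Longrightarrow> sup f g \<in> E"
  and sublattice_of_inf: "sublattice_of E C \<Longrightarrow> f \<in> E \<Longrightarrow> g \<in> E \<Longrightarrow> inf f g \<in> E"
  and sublattice_of_subset: "sublattice_of E C \<Longrightarrow> E \<subseteq> C"
  unfolding sublattice_of_def function_subspace_def by blast+

lemma sublattice_of_diff:
  assumes "sublattice_of E C" "f \<in> E" "g \<in> E"
  shows "(\<lambda>x. f x - g x) \<in> E"
  using sublattice_of_add[OF assms(1,2) sublattice_of_scale[OF assms(1,3), of "-1"]] by simp

lemma sublattice_of_pos_part:
  assumes "sublattice_of E C" "f \<in> E"
  shows "(\<lambda>x. max (f x) 0) \<in> E"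
proof -
  have "sup f (\<lambda>_. 0) = (\<lambda>x. max (f x) 0)"
    by (simp add: fun_eq_iff sup_max)
  then show ?thesis
    using sublattice_of_sup[OF assms sublattice_of_zero[OF assms(1)]] by simp
qed

lemma sublattice_of_abs:
  assumes "sublattice_of E C" "f \<in> E"
  shows "(\<lambda>x. \<bar>f x\<bar>) \<in> E"
proof -
  have "sup f (\<lambda>x. (-1) * f x) = (\<lambda>x. \<bar>f x\<bar>)"
    by (auto simp add: fun_eq_iff sup_max)
  then show ?thesis
    using sublattice_of_sup[OF assms sublattice_of_scale[OF assms, of "-1"]] by simp
qed

lemma ideal_of_zero: "ideal_of H E \<Longrightarrow> (\<lambda>_. 0) \<in> H"
  and ideal_of_add: "ideal_of H E \<Longrightarrow> f \<in> H \<Longrightarrow> g \<in> H \<Longrightarrow> (\<lambda>x. f x + g x) \<in> H"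
  and ideal_of_subset: "ideal_of H E \<Longrightarrow> H \<subseteq> E"
  unfolding ideal_of_def function_subspace_def by blast+

lemma ideal_of_dominated:
  assumes "ideal_of H E" "h \<in> H" "f \<in> E" "\<And>x. \<bar>f x\<bar> \<le> \<bar>h x\<bar>"
  shows "f \<in> H"
  using assms unfolding ideal_of_def by (metis le_funI)

lemma ideal_of_abs:
  assumes "sublattice_of E C" "ideal_of H E" "h \<in> H"
  shows "(\<lambda>x. \<bar>h x\<bar>) \<in> H"
proof (rule ideal_of_dominated[OF assms(2,3)])
  show "(\<lambda>x. \<bar>h x\<bar>) \<in> E"
    using sublattice_of_abs[OF assms(1)] ideal_of_subset[OF assms(2)] assms(3) by blast
qed simp

text \<open>Both lattice operations of \<open>f\<close> and \<open>g\<close> are dominated by \<open>\<bar>f\<bar> + \<bar>g\<bar>\<close>.\<close>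

lemma ideal_of_imp_sublattice_of:
  assumes "sublattice_of E C" "ideal_of H E"
  shows "sublattice_of H E"
proof -
  have "sup f g \<in> H \<and> inf f g \<in> H" if "f \<in> H" "g \<in> H" for f g
  proof -
    have E: "f \<in> E" "g \<in> E"
      using that ideal_of_subset[OF assms(2)] by auto
    have s: "(\<lambda>x. \<bar>f x\<bar> + \<bar>g x\<bar>) \<in> H"
      using ideal_of_add[OF assms(2) ideal_of_abs[OF assms that(1)] ideal_of_abs[OF assms that(2)]] .
    show ?thesis
      using ideal_of_dominated[OF assms(2) s sublattice_of_sup[OF assms(1) E]]
        ideal_of_dominated[OF assms(2) s sublattice_of_inf[OF assms(1) E]]
      by (auto simp: sup_max inf_min max_def min_def)
  qed
  then show ?thesis
    using assms(2) unfolding sublattice_of_def ideal_of_def by blast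
qed

lemma zero_less_fun_iff:
  fixes e :: "'a \<Rightarrow> real"
  shows "(\<lambda>_. 0) < e \<longleftrightarrow> (\<forall>x. 0 \<le> e x) \<and> (\<exists>x. 0 < e x)"
  by (simp add: less_fun_def le_fun_def not_le)

lemma mem_supp_family: "x \<in> supp_family G \<longleftrightarrow> (\<exists>g\<in>G. g x \<noteq> 0)"
  by (auto simp: supp_family_def support_on_def)

lemma supp_family_mono: "G \<subseteq> G' \<Longrightarrow> supp_family G \<subseteq> supp_family G'"
  by (auto simp: supp_family_def)

lemma sublattice_of_cont_functions_continuous:
  "sublattice_of E cont_functions \<Longrightarrow> f \<in> E \<Longrightarrow> continuous_on UNIV f"
  using sublattice_of_subset by (force simp: cont_functions_def)

section \<open>Dense support implies order density\<close>

lemma dense_supp_imp_order_dense: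
  fixes E :: "('a::topological_space \<Rightarrow> real) set"
  assumes E: "sublattice_of E cont_functions" and H: "ideal_of H E"
    and dense: "dense_subset_of (supp_family H) (supp_family E)"
  shows "order_dense_in H E"
  unfolding order_dense_in_def
proof (intro conjI ballI impI)
  show "sublattice_of H E"
    using ideal_of_imp_sublattice_of[OF E H] .
next
  fix e assume e: "e \<in> E" and "(\<lambda>_. 0) < e"
  then obtain x where nonneg: "\<And>x. 0 \<le> e x" and x: "0 < e x"
    by (auto simp: zero_less_fun_iff)
  have "open {y. 0 < e y}"
    by (intro open_Collect_less continuous_on_const sublattice_of_cont_functions_continuous[OF E e])
  moreover have "x \<in> closure (supp_family H)"
    using dense e x unfolding dense_subset_of_def by (force simp: mem_supp_family)
  ultimately obtain y where y: "y \<in> supp_family H" "0 < e y"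
    using x by (auto simp: closure_iff_nhds_not_empty)
  then obtain h where h: "h \<in> H" "h y \<noteq> 0"
    by (auto simp: mem_supp_family)
  have abs_h: "(\<lambda>x. \<bar>h x\<bar>) \<in> H"
    using ideal_of_abs[OF E H h(1)] .
  have "inf (\<lambda>x. \<bar>h x\<bar>) e \<in> E"
    using sublattice_of_inf[OF E _ e] abs_h ideal_of_subset[OF H] by blast
  then have "inf (\<lambda>x. \<bar>h x\<bar>) e \<in> H"
    using ideal_of_dominated[OF H abs_h] nonneg by (simp add: inf_min)
  moreover have "(\<lambda>_. 0) < inf (\<lambda>x. \<bar>h x\<bar>) e"
    using nonneg y(2) h(2) unfolding zero_less_fun_iff by (auto simp: inf_min intro!: exI[of _ y])
  moreover have "inf (\<lambda>x. \<bar>h x\<bar>) e \<le> e"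
    by simp
  ultimately show "\<exists>h\<in>H. (\<lambda>_. 0) < h \<and> h \<le> e"
    by blast
qed

section \<open>Order dense ideals of regular sublattices\<close>

text \<open>
  If \<open>g\<close> is an upper bound of the displayed set that is not above \<open>e\<close>, order density provides
  \<open>0 < h \<le> (e - g)\<^sup>+\<close> in \<open>H\<close>. Adding \<open>h\<close> to a member of the set leaves it below \<open>e\<close>,
  because the member is below both \<open>g\<close> and \<open>e\<close>; so all multiples of \<open>h\<close> are below \<open>e\<close>,
  which contradicts the Archimedean property.
\<close>

lemma isLub_order_dense_ideal:
  assumes E: "sublattice_of E C" and H: "ideal_of H E" and dense: "order_dense_in H E"
    and e: "e \<in> E" "\<And>x. 0 \<le> e x"
  shows "isLub E {h \<in> H. (\<forall>x. 0 \<le> h x) \<and> h \<le> e} e" (is "isLub E ?R e")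
proof (rule isLubI2)
  show "isUb E ?R e"
    using e by (auto intro!: isUbI setleI)
next
  show "e <=* Collect (isUb E ?R)"
  proof (intro setgeI ballI)
    fix g assume "g \<in> Collect (isUb E ?R)"
    then have g: "g \<in> E" and ub: "\<And>f. f \<in> ?R \<Longrightarrow> f \<le> g"
      by (auto simp: isUb_def setle_def)
    show "e \<le> g"
    proof (rule ccontr)
      assume "\<not> e \<le> g"
      then obtain z where "g z < e z"
        by (auto simp: le_fun_def not_le)
      then have "(\<lambda>_. 0) < (\<lambda>x. max (e x - g x) 0)"
        by (auto simp: zero_less_fun_iff intro!: exI[of _ z])
      moreover have "(\<lambda>x. max (e x - g x) 0) \<in> E"
        using sublattice_of_pos_part[OF E sublattice_of_diff[OF E e(1) g]] .
      ultimately obtain h where h: "h \<in> H" "(\<lambda>_. 0) < h" "h \<le> (\<lambda>x. max (e x - g x) 0)"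
        using dense unfolding order_dense_in_def by blast
      then obtain y where nonneg: "\<And>x. 0 \<le> h x" and y: "0 < h y"
        by (auto simp: zero_less_fun_iff)
      have step: "(\<lambda>x. f x + h x) \<in> ?R" if f: "f \<in> ?R" for f
      proof -
        have "f x + h x \<le> e x" for x
          using le_funD[OF ub[OF f], of x] le_funD[OF h(3), of x] f
          by (auto simp: le_fun_def max_def split: if_splits dest!: spec[of _ x])
        then show ?thesis
          using f nonneg ideal_of_add[OF H _ h(1)] by (simp add: le_fun_def)
      qed
      have multiples: "(\<lambda>x. real n * h x) \<in> ?R" for n
      proof (induction n)
        case 0
        then show ?case
          using ideal_of_zero[OF H] e by (simp add: le_fun_def)
      next
        case (Suc n)
        then show ?case
          using step[OF Suc.IH] by (simp add: algebra_simps)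
      qed
      obtain n where "e y < real n * h y"
        using reals_Archimedean3[OF y] by blast
      then show False
        using multiples[of n] by (auto simp: le_fun_def not_le dest!: spec[of _ y])
    qed
  qed
qed

lemma regular_order_dense_imp_dense_supp:
  fixes E :: "('a::topological_space \<Rightarrow> real) set"
  assumes cr: "completely_regular_space (euclidean :: 'a topology)"
    and reg: "regular_sublattice E" and H: "ideal_of H E" and dense: "order_dense_in H E"
  shows "dense_subset_of (supp_family H) (supp_family E)"
  unfolding dense_subset_of_def
proof (intro conjI subsetI)
  show "\<And>x. x \<in> supp_family H \<Longrightarrow> x \<in> supp_family E"
    using supp_family_mono[OF ideal_of_subset[OF H]] by blast
next
  fix x assume "x \<in> supp_family E"
  then obtain e0 where "e0 \<in> E" "e0 x \<noteq> 0"
    by (auto simp: mem_supp_family)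
  have E: "sublattice_of E cont_functions"
    using reg by (simp add: regular_sublattice_def)
  define e where "e = (\<lambda>x. \<bar>e0 x\<bar>)"
  have e: "e \<in> E" "\<And>x. 0 \<le> e x" "0 < e x"
    using sublattice_of_abs[OF E \<open>e0 \<in> E\<close>] \<open>e0 x \<noteq> 0\<close> by (auto simp: e_def)
  define R where "R = {h \<in> H. (\<forall>x. 0 \<le> h x) \<and> h \<le> e}"
  have "isLub E R e"
    unfolding R_def using isLub_order_dense_ideal[OF E H dense e(1,2)] .
  moreover have "R \<subseteq> E" "R \<noteq> {}"
    using ideal_of_subset[OF H] ideal_of_zero[OF H] e(2) by (auto simp: R_def le_fun_def)
  ultimately have lub: "isLub cont_functions R e"
    using reg unfolding regular_sublattice_def by blast
  show "x \<in> closure (supp_family H)"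
  proof (rule ccontr)
    assume "x \<notin> closure (supp_family H)"
    then obtain f :: "'a \<Rightarrow> real"
      where f: "continuous_map euclidean (top_of_set {0..1}) f" "f x = 0"
        "f ` closure (supp_family H) \<subseteq> {1}"
      using cr unfolding completely_regular_space_def
      by (metis DiffI UNIV_I closed_closedin closed_closure topspace_euclidean)
    then have f_cont: "continuous_on UNIV f" and range: "\<And>y. 0 \<le> f y"
      by (auto simp: continuous_map_in_subtopology)
    have "h y \<le> e y * f y" if "h \<in> R" for h y
    proof (cases "h y = 0")
      case True
      then show ?thesis
        using e(2)[of y] range[of y] by simp
    next
      case False
      then have "y \<in> closure (supp_family H)"
        using that closure_subset by (force simp: R_def mem_supp_family)
      then show ?thesis
        using f(3) that by (force simp: R_def le_fun_def)
    qed
    moreover have "(\<lambda>y. e y * f y) \<in> cont_functions"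
      using sublattice_of_cont_functions_continuous[OF E e(1)] f_cont
      by (auto simp: cont_functions_def intro: continuous_on_mult)
    ultimately have "isUb cont_functions R (\<lambda>y. e y * f y)"
      by (auto intro!: isUbI setleI le_funI)
    then have "e \<le> (\<lambda>y. e y * f y)"
      using lub by (rule isLub_le_isUb[rotated])
    then show False
      using f(2) e(3) by (auto simp: le_fun_def not_le dest!: spec[of _ x])
  qed
qed

section \<open>Order dense ideals with small support\<close>

text \<open>
  A supremum \<open>r\<close> of \<open>R\<close> in \<open>E\<close> that fails to be one in \<open>C(X)\<close> yields \<open>F = r - R\<close>: an upper
  bound \<open>g\<close> of \<open>R\<close> in \<open>C(X)\<close> with \<open>g x < r x\<close> makes \<open>r - g\<close> a lower bound of \<open>F\<close> that is
  positive near \<open>x\<close>. An infimum is treated in the same way with \<open>F = R - r\<close>.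
\<close>

lemma not_regular_witness:
  fixes E :: "('a::topological_space \<Rightarrow> real) set"
  assumes E: "sublattice_of E cont_functions" and "\<not> regular_sublattice E"
  obtains F U \<delta> where "F \<subseteq> E" "F \<noteq> {}" "\<And>f x. f \<in> F \<Longrightarrow> 0 \<le> f x"
    "\<And>e x. e \<in> E \<Longrightarrow> (\<And>f. f \<in> F \<Longrightarrow> e \<le> f) \<Longrightarrow> e x \<le> 0"
    "open U" "U \<noteq> {}" "0 < \<delta>" "\<And>f x. f \<in> F \<Longrightarrow> x \<in> U \<Longrightarrow> \<delta> \<le> f x"
proof -
  have "\<exists>F c x. F \<subseteq> E \<and> F \<noteq> {} \<and> (\<forall>f\<in>F. \<forall>x. 0 \<le> f x) \<and>
      (\<forall>e\<in>E. (\<forall>f\<in>F. e \<le> f) \<longrightarrow> (\<forall>x. e x \<le> 0)) \<and>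
      continuous_on UNIV c \<and> (\<forall>f\<in>F. c \<le> f) \<and> 0 < c x"
  proof -
    obtain R r where R: "R \<subseteq> E" "R \<noteq> {}"
      and "isLub E R r \<and> \<not> isLub cont_functions R r \<or> isGlb E R r \<and> \<not> isGlb cont_functions R r"
      using assms unfolding regular_sublattice_def by blast
    then consider (lub) "isLub E R r" "\<not> isLub cont_functions R r"
      | (glb) "isGlb E R r" "\<not> isGlb cont_functions R r"
      by blast
    then show ?thesis
    proof cases
      case lub
      have r: "r \<in> E" "\<And>f. f \<in> R \<Longrightarrow> f \<le> r"
        using lub(1) by (auto simp: isLub_def leastP_def isUb_def setle_def)
      have least: "r \<le> g" if "g \<in> E" "\<And>f. f \<in> R \<Longrightarrow> f \<le> g" for g
        using isLub_le_isUb[OF lub(1)] that by (simp add: isUb_def setle_def)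
      obtain g where g: "g \<in> cont_functions" "\<And>f. f \<in> R \<Longrightarrow> f \<le> g" "\<not> r \<le> g"
        using lub(2) r sublattice_of_subset[OF E]
        by (auto simp: isLub_def leastP_def isUb_def setle_def setge_def)
      obtain x where x: "g x < r x"
        using g(3) by (auto simp: le_fun_def not_le)
      define F where "F = (\<lambda>f x. r x - f x) ` R"
      have "F \<subseteq> E" "F \<noteq> {}"
        using R r(1) sublattice_of_diff[OF E] by (auto simp: F_def)
      moreover have "\<forall>f\<in>F. \<forall>x. 0 \<le> f x"
        using r(2) by (auto simp: F_def le_fun_def)
      moreover have "e y \<le> 0" if e: "e \<in> E" "\<forall>f\<in>F. e \<le> f" for e y
      proof -
        have "f z \<le> r z - e z" if "f \<in> R" for f z
          using e(2) that by (auto simp: F_def le_fun_def algebra_simps)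
        then have "r \<le> (\<lambda>z. r z - e z)"
          using sublattice_of_diff[OF E r(1) e(1)] by (intro least) (auto simp: le_fun_def)
        then show ?thesis
          by (auto simp: le_fun_def dest!: spec[of _ y])
      qed
      moreover have "continuous_on UNIV (\<lambda>x. r x - g x)"
        using g(1) sublattice_of_cont_functions_continuous[OF E r(1)]
        by (auto simp: cont_functions_def intro: continuous_on_diff)
      moreover have "\<forall>f\<in>F. (\<lambda>x. r x - g x) \<le> f"
        using g(2) by (auto simp: F_def le_fun_def)
      ultimately show ?thesis
        using x by (intro exI[of _ F] exI[of _ "\<lambda>x. r x - g x"] exI[of _ x]) auto
    next
      case glb
      have r: "r \<in> E" "\<And>f. f \<in> R \<Longrightarrow> r \<le> f"
        using glb(1) by (auto simp: isGlb_def greatestP_def isLb_def setge_def)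
      have greatest: "g \<le> r" if "g \<in> E" "\<And>f. f \<in> R \<Longrightarrow> g \<le> f" for g
        using glb(1) that by (auto simp: isGlb_def greatestP_def isLb_def setge_def setle_def)
      obtain g where g: "g \<in> cont_functions" "\<And>f. f \<in> R \<Longrightarrow> g \<le> f" "\<not> g \<le> r"
        using glb(2) r sublattice_of_subset[OF E]
        by (auto simp: isGlb_def greatestP_def isLb_def setge_def setle_def)
      obtain x where x: "r x < g x"
        using g(3) by (auto simp: le_fun_def not_le)
      define F where "F = (\<lambda>f x. f x - r x) ` R"
      have "F \<subseteq> E" "F \<noteq> {}"
        using R r(1) sublattice_of_diff[OF E] by (auto simp: F_def)
      moreover have "\<forall>f\<in>F. \<forall>x. 0 \<le> f x"
        using r(2) by (auto simp: F_def le_fun_def)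
      moreover have "e y \<le> 0" if e: "e \<in> E" "\<forall>f\<in>F. e \<le> f" for e y
      proof -
        have "r z + e z \<le> f z" if "f \<in> R" for f z
          using e(2) that by (auto simp: F_def le_fun_def algebra_simps)
        then have "(\<lambda>z. r z + e z) \<le> r"
          using sublattice_of_add[OF E r(1) e(1)] by (intro greatest) (auto simp: le_fun_def)
        then show ?thesis
          by (auto simp: le_fun_def dest!: spec[of _ y])
      qed
      moreover have "continuous_on UNIV (\<lambda>x. g x - r x)"
        using g(1) sublattice_of_cont_functions_continuous[OF E r(1)]
        by (auto simp: cont_functions_def intro: continuous_on_diff)
      moreover have "\<forall>f\<in>F. (\<lambda>x. g x - r x) \<le> f"
        using g(2) by (auto simp: F_def le_fun_def)
      ultimately show ?thesis
        using x by (intro exI[of _ F] exI[of _ "\<lambda>x. g x - r x"] exI[of _ x]) auto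
    qed
  qed
  then obtain F c x where F: "F \<subseteq> E" "F \<noteq> {}" "\<forall>f\<in>F. \<forall>x. 0 \<le> f x"
      "\<forall>e\<in>E. (\<forall>f\<in>F. e \<le> f) \<longrightarrow> (\<forall>x. e x \<le> 0)"
    and c: "continuous_on UNIV c" "\<forall>f\<in>F. c \<le> f" "0 < c x"
    by blast
  have "open {y. c x / 2 < c y}"
    by (intro open_Collect_less continuous_on_const c(1))
  moreover have "{y. c x / 2 < c y} \<noteq> {}"
    using c(3) by (auto intro!: exI[of _ x])
  moreover have "c x / 2 \<le> f y" if "f \<in> F" "y \<in> {y. c x / 2 < c y}" for f y
    using that le_funD[of c f y] c(2) by fastforce
  ultimately show ?thesis
    using that[of F "{y. c x / 2 < c y}" "c x / 2"] F c(3) by auto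
qed

lemma vanishing_ideal:
  assumes "sublattice_of E C"
  shows "ideal_of {h \<in> E. \<forall>x\<in>V. h x = 0} E"
proof -
  have "f x = 0" if "\<bar>f x\<bar> \<le> \<bar>h x\<bar>" "h x = 0" for f h :: "'a \<Rightarrow> real" and x
    using that by simp
  then show ?thesis
    using sublattice_of_zero[OF assms] sublattice_of_add[OF assms] sublattice_of_scale[OF assms]
    unfolding ideal_of_def function_subspace_def le_fun_def by (simp; blast)
qed

text \<open>
  Subtracting a large multiple of \<open>f \<in> F\<close> from \<open>e\<close> makes the difference nonpositive on \<open>V\<close>, so
  that its positive part vanishes there; the multiple depends only on the bound of \<open>e\<close> on \<open>V\<close>, so
  that the positive parts cannot be zero for all \<open>f\<close> at once.
\<close>

lemma vanishing_ideal_order_dense: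
  assumes E: "sublattice_of E C"
    and F: "F \<subseteq> E" "\<And>f x. f \<in> F \<Longrightarrow> 0 \<le> f x"
    and no_lower: "\<And>e x. e \<in> E \<Longrightarrow> (\<And>f. f \<in> F \<Longrightarrow> e \<le> f) \<Longrightarrow> e x \<le> 0"
    and \<delta>: "0 < \<delta>" "\<And>f x. f \<in> F \<Longrightarrow> x \<in> V \<Longrightarrow> \<delta> \<le> f x"
    and bdd: "\<And>e. e \<in> E \<Longrightarrow> bounded (e ` V)"
  shows "order_dense_in {h \<in> E. \<forall>x\<in>V. h x = 0} E"
  unfolding order_dense_in_def
proof (intro conjI ballI impI)
  show "sublattice_of {h \<in> E. \<forall>x\<in>V. h x = 0} E"
    using ideal_of_imp_sublattice_of[OF E vanishing_ideal[OF E]] .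
next
  fix e assume e: "e \<in> E" and "(\<lambda>_. 0) < e"
  then obtain z where nonneg: "\<And>x. 0 \<le> e x" and z: "0 < e z"
    by (auto simp: zero_less_fun_iff)
  obtain M where M: "0 < M" "\<And>x. x \<in> V \<Longrightarrow> e x \<le> M"
    using bdd[OF e] by (force simp: bounded_pos)
  define t where "t = M / \<delta>"
  have t: "0 < t" "t * \<delta> = M"
    using M(1) \<delta>(1) by (auto simp: t_def)
  have "(\<lambda>x. (1 / t) * e x) \<in> E"
    using sublattice_of_scale[OF E e] .
  moreover have "\<not> (1 / t) * e z \<le> 0"
    using z t(1) by (simp add: not_le)
  ultimately obtain f where f: "f \<in> F" and "\<not> (\<lambda>x. (1 / t) * e x) \<le> f"
    using no_lower[of "\<lambda>x. (1 / t) * e x" z] by blast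
  then obtain y where "f y < (1 / t) * e y"
    by (auto simp: le_fun_def not_le)
  then have y: "t * f y < e y"
    using t(1) by (simp add: field_simps)
  define h where "h = (\<lambda>x. max (e x - t * f x) 0)"
  have "(\<lambda>x. t * f x) \<in> E"
    using sublattice_of_scale[OF E] f F(1) by blast
  then have "h \<in> E"
    unfolding h_def by (intro sublattice_of_pos_part[OF E] sublattice_of_diff[OF E e])
  moreover have "h x = 0" if "x \<in> V" for x
  proof -
    have "e x \<le> t * \<delta>"
      using M(2)[OF that] t(2) by simp
    also have "\<dots> \<le> t * f x"
      using \<delta>(2)[OF f that] t(1) by simp
    finally show ?thesis
      by (simp add: h_def)
  qed
  moreover have "(\<lambda>_. 0) < h"
    using y by (auto simp: zero_less_fun_iff h_def intro!: exI[of _ y])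
  moreover have "h \<le> e"
    using F(2)[OF f] t(1) nonneg by (auto simp: h_def le_fun_def)
  ultimately show "\<exists>h\<in>{h \<in> E. \<forall>x\<in>V. h x = 0}. (\<lambda>_. 0) < h \<and> h \<le> e"
    by blast
qed

text \<open>
  The two alternative hypotheses of (iii) serve the same end: either every member of \<open>E\<close> is
  bounded already on \<open>U\<close>, or \<open>U\<close> meets the interior of a compact set.
\<close>

lemma bounded_on_open_subset:
  fixes E :: "('a::topological_space \<Rightarrow> real) set"
  assumes E: "sublattice_of E cont_functions"
    and "E \<subseteq> bounded_cont_functions \<or> almost_locally_compact TYPE('a)"
    and U: "open U" "U \<noteq> {}"
  obtains V where "open V" "V \<noteq> {}" "V \<subseteq> U" "\<And>e. e \<in> E \<Longrightarrow> bounded (e ` V)"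
  using assms(2)
proof
  assume "E \<subseteq> bounded_cont_functions"
  then have "bounded (e ` U)" if "e \<in> E" for e
    using that bounded_subset[of "range e" "e ` U"] by (auto simp: bounded_cont_functions_def)
  then show ?thesis
    using that[of U] U by blast
next
  assume "almost_locally_compact TYPE('a)"
  then have "closure {x::'a. \<exists>K. compact K \<and> x \<in> interior K} = UNIV"
    by (simp add: almost_locally_compact_def)
  then have "U \<inter> {x. \<exists>K. compact K \<and> x \<in> interior K} \<noteq> {}"
    using U open_Int_closure_eq_empty[OF U(1)] by blast
  then obtain x K where K: "x \<in> U" "compact K" "x \<in> interior K"
    by blast
  have "bounded (e ` (U \<inter> interior K))" if "e \<in> E" for e
  proof (rule bounded_subset)
    show "bounded (e ` K)"
      using continuous_on_subset[OF sublattice_of_cont_functions_continuous[OF E that] subset_UNIV] K(2)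
      by (intro compact_imp_bounded compact_continuous_image)
    show "e ` (U \<inter> interior K) \<subseteq> e ` K"
      using interior_subset by blast
  qed
  then show ?thesis
    using that[of "U \<inter> interior K"] U(1) K by blast
qed

lemma not_regular_imp_order_dense_ideal:
  fixes E :: "('a::topological_space \<Rightarrow> real) set"
  assumes E: "sublattice_of E cont_functions" and "\<not> regular_sublattice E"
    and "E \<subseteq> bounded_cont_functions \<or> almost_locally_compact TYPE('a)"
  shows "\<exists>H. ideal_of H E \<and> order_dense_in H E \<and>
    \<not> dense_subset_of (supp_family H) (supp_family E)"
proof -
  obtain F U \<delta> where F: "F \<subseteq> E" "F \<noteq> {}" "\<And>f x. f \<in> F \<Longrightarrow> 0 \<le> f x"
    and no_lower: "\<And>e x. e \<in> E \<Longrightarrow> (\<And>f. f \<in> F \<Longrightarrow> e \<le> f) \<Longrightarrow> e x \<le> 0"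
    and U: "open U" "U \<noteq> {}"
    and \<delta>: "0 < \<delta>" "\<And>f x. f \<in> F \<Longrightarrow> x \<in> U \<Longrightarrow> \<delta> \<le> f x"
    using not_regular_witness[OF assms(1,2)] by blast
  obtain V where V: "open V" "V \<noteq> {}" "V \<subseteq> U" and bdd: "\<And>e. e \<in> E \<Longrightarrow> bounded (e ` V)"
    using bounded_on_open_subset[OF E assms(3) U] by blast
  define H where "H = {h \<in> E. \<forall>x\<in>V. h x = 0}"
  have "order_dense_in H E"
    unfolding H_def
  proof (rule vanishing_ideal_order_dense)
    show "e x \<le> 0" if "e \<in> E" "\<And>f. f \<in> F \<Longrightarrow> e \<le> f" for e x
      using no_lower that .
    show "\<And>f x. f \<in> F \<Longrightarrow> x \<in> V \<Longrightarrow> \<delta> \<le> f x"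
      using \<delta>(2) V(3) by blast
  qed (use E F(1,3) \<delta>(1) bdd in auto)
  moreover have "\<not> dense_subset_of (supp_family H) (supp_family E)"
  proof
    assume dense: "dense_subset_of (supp_family H) (supp_family E)"
    obtain f x where f: "f \<in> F" and x: "x \<in> V"
      using F(2) V(2) by blast
    have "0 < f x"
      using \<delta>(1) \<delta>(2)[OF f, of x] x V(3) by force
    then have "x \<in> supp_family E"
      using f F(1) by (auto simp: mem_supp_family intro!: bexI[of _ f])
    then have "x \<in> closure (supp_family H)"
      using dense by (auto simp: dense_subset_of_def)
    then have "supp_family H \<inter> V \<noteq> {}"
      using x open_Int_closure_eq_empty[OF V(1), of "supp_family H"] by blast
    then show False
      by (auto simp: mem_supp_family H_def)
  qed
  ultimately show ?thesis
    using vanishing_ideal[OF E, of V] unfolding H_def by blast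
qed

theorem proposition2p18:
  fixes E :: "('a::topological_space \<Rightarrow> real) set"
  assumes "tychonoff_space (euclidean :: 'a topology)"
    and "sublattice_of E cont_functions"
  shows "(\<forall>H. ideal_of H E \<and> dense_subset_of (supp_family H) (supp_family E)
            \<longrightarrow> order_dense_in H E) \<and>
         (regular_sublattice E \<longrightarrow>
            (\<forall>H. ideal_of H E \<and> order_dense_in H E
              \<longrightarrow> dense_subset_of (supp_family H) (supp_family E))) \<and>
         (\<not> regular_sublattice E \<and>
            (E \<subseteq> bounded_cont_functions \<or> almost_locally_compact TYPE('a))
            \<longrightarrow> (\<exists>H. ideal_of H E \<and> order_dense_in H E \<and>
                  \<not> dense_subset_of (supp_family H) (supp_family E)))"
  using assms dense_supp_imp_order_dense[OF assms(2)] regular_order_dense_imp_dense_supp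
    not_regular_imp_order_dense_ideal[OF assms(2)]
  unfolding tychonoff_space_def by blast

end
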